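(* Let $m\geq 0$ and $n\geq 1$ be integers and let $a$ be a real number. Define $$ A_{m,n}(a)=\sum_{j=0}^m (-4)^j \binom{m+j}{2j}\sum_{k=0}^{n-1} \sin\left(a+\frac{2k\pi}{n}\right) \cos^{2j}\left(a+\frac{2k\pi}{n}\right) $$ and $$ B_{m,n}(a)=\sum_{j=0}^m (-4)^j \binom{m+j+1}{2j+1}\sum_{k=0}^{n-1} \sin\left(a+\frac{2k\pi}{n}\right) \cos^{2j+1}\left(a+\frac{2k\pi}{n}\right). $$ Then the following hold. (i) If $2m+1 \equiv 0 \pmod n$, then $A_{m,n}(a)=(-1)^m\, n \sin((2m+1)a)$. (ii) If $2m+1 \not\equiv 0 \pmod n$, then $A_{m,n}(a)=0$. (iii) If $2(m+1) \equiv 0 \pmod n$, then $B_{m,n}(a)=(-1)^m\, \frac{n}{2} \sin(2(m+1)a)$. (iv) If $2(m+1) \not\equiv 0 \pmod n$, then $B_{m,n}(a)=0$.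
   Context: Here $\cos^{p}(\theta)$ denotes $(\cos\theta)^p$, with $\cos^0(\theta)=1$ for every real $\theta$ (including when $\cos\theta=0$), and $\binom{r}{s}$ is the usual binomial coefficient. *)

theory Defs
  imports Complex_Main "HOL-Number_Theory.Cong"
begin

definition A_sum :: "nat \<Rightarrow> nat \<Rightarrow> real \<Rightarrow> real" where
  "A_sum m n a =
     (\<Sum>j=0..m. (-4) ^ j * real ((m + j) choose (2 * j)) *
        (\<Sum>k=0..<n. sin (a + 2 * real k * pi / real n) *
                      cos (a + 2 * real k * pi / real n) ^ (2 * j)))"

definition B_sum :: "nat \<Rightarrow> nat \<Rightarrow> real \<Rightarrow> real" where
  "B_sum m n a =
     (\<Sum>j=0..m. (-4) ^ j * real ((m + j + 1) choose (2 * j + 1)) *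
        (\<Sum>k=0..<n. sin (a + 2 * real k * pi / real n) *
                      cos (a + 2 * real k * pi / real n) ^ (2 * j + 1)))"

end

theory Submission
  imports Defs
begin

text \<open>Put \<open>y = -4 cos\<^sup>2 \<theta>\<close>. Pascal's rule gives a coupled first-order recurrence in \<open>m\<close> for the
  polynomials \<open>\<Sum>j. binom(m+j, 2j) y\<^sup>j\<close> and \<open>\<Sum>j. binom(m+j+1, 2j+1) y\<^sup>j\<close>. After multiplication by
  \<open>sin \<theta>\<close> and \<open>sin \<theta> cos \<theta>\<close> respectively, the product formula for \<open>cos \<theta> sin (N \<theta>)\<close> shows that
  \<open>(-1)\<^sup>m sin ((2m+1) \<theta>)\<close> and \<open>(-1)\<^sup>m sin ((2m+2) \<theta>) / 2\<close> satisfy the same recurrence. It remains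
  to sum \<open>sin (N \<theta>)\<close> over \<open>n\<close> equally spaced angles, which gives zero unless \<open>n\<close> divides \<open>N\<close>.\<close>

text \<open>This and \<open>odd_binomial_poly\<close> are the two families of Morgan-Voyce
  polynomials, usually written b_m and B_m.\<close>

definition even_binomial_poly :: "nat \<Rightarrow> 'a::comm_semiring_1 \<Rightarrow> 'a" where
  "even_binomial_poly m y = (\<Sum>j\<le>m. of_nat ((m + j) choose (2 * j)) * y ^ j)"

definition odd_binomial_poly :: "nat \<Rightarrow> 'a::comm_semiring_1 \<Rightarrow> 'a" where
  "odd_binomial_poly m y = (\<Sum>j\<le>m. of_nat ((m + j + 1) choose (2 * j + 1)) * y ^ j)"

lemma even_binomial_poly_Suc:
  "even_binomial_poly (Suc m) y = even_binomial_poly m y + y * odd_binomial_poly m y"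
proof -
  \<comment> \<open>The constant term is split off because Pascal's rule needs a positive lower
    index.\<close>
  have "even_binomial_poly (Suc m) y =
      1 + (\<Sum>j\<le>m. of_nat ((Suc m + Suc j) choose (2 * Suc j)) * y ^ Suc j)"
    unfolding even_binomial_poly_def by (subst sum.atMost_Suc_shift) simp
  also have "\<dots> = 1 + (\<Sum>j\<le>m. of_nat ((m + Suc j) choose (2 * Suc j)) * y ^ Suc j)
      + y * odd_binomial_poly m y"
    by (simp add: odd_binomial_poly_def sum_distrib_left sum.distrib[symmetric] algebra_simps)
  also have "1 + (\<Sum>j\<le>m. of_nat ((m + Suc j) choose (2 * Suc j)) * y ^ Suc j) =
      (\<Sum>j\<le>Suc m. of_nat ((m + j) choose (2 * j)) * y ^ j)"
    by (subst sum.atMost_Suc_shift) simp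
  \<comment> \<open>The extra top term has coefficient binom(2m+1, 2m+2) = 0.\<close>
  also have "\<dots> = even_binomial_poly m y"
    by (simp add: even_binomial_poly_def binomial_eq_0)
  finally show ?thesis .
qed

lemma odd_binomial_poly_Suc:
  "odd_binomial_poly (Suc m) y = odd_binomial_poly m y + even_binomial_poly (Suc m) y"
proof -
  have "odd_binomial_poly (Suc m) y =
      (\<Sum>j\<le>Suc m. of_nat ((m + j + 1) choose (2 * j + 1)) * y ^ j) + even_binomial_poly (Suc m) y"
    unfolding odd_binomial_poly_def even_binomial_poly_def sum.distrib[symmetric]
    by (intro sum.cong) (simp_all add: algebra_simps)
  \<comment> \<open>Here too the top coefficient, binom(2m+2, 2m+3), vanishes.\<close>
  also have "(\<Sum>j\<le>Suc m. of_nat ((m + j + 1) choose (2 * j + 1)) * y ^ j) = odd_binomial_poly m y"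
    by (simp add: odd_binomial_poly_def binomial_eq_0)
  finally show ?thesis .
qed

text \<open>The recurrences are coupled, so both identities go through one induction; the even one
  at \<open>Suc m\<close> comes first because the odd one uses it.\<close>

lemma sin_times_binomial_polys:
  fixes t :: real
  shows "sin t * even_binomial_poly m (-4 * (cos t)\<^sup>2) = (-1) ^ m * sin (real (2 * m + 1) * t) \<and>
    sin t * cos t * odd_binomial_poly m (-4 * (cos t)\<^sup>2) =
      (-1) ^ m * sin (real (2 * (m + 1)) * t) / 2"
proof (induction m)
  case 0
  show ?case
    by (simp add: even_binomial_poly_def odd_binomial_poly_def sin_double)
next
  case (Suc m)
  let ?y = "-4 * (cos t)\<^sup>2"
  have product: "2 * cos t * sin (x * t) = sin ((x + 1) * t) + sin ((x - 1) * t)" for x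
    by (simp add: distrib_right left_diff_distrib sin_add sin_diff)
  have "sin t * even_binomial_poly (Suc m) ?y =
      sin t * even_binomial_poly m ?y - 4 * cos t * (sin t * cos t * odd_binomial_poly m ?y)"
    by (simp add: even_binomial_poly_Suc algebra_simps power2_eq_square)
  also have "\<dots> = (-1) ^ m * (sin (real (2 * m + 1) * t) - 2 * cos t * sin (real (2 * (m + 1)) * t))"
    unfolding Suc.IH[THEN conjunct1] Suc.IH[THEN conjunct2] by (simp add: algebra_simps)
  \<comment> \<open>\<open>product\<close> at x = 2m+2 cancels sin((2m+1)t) and leaves
    -sin((2m+3)t).\<close>
  also have "\<dots> = (-1) ^ Suc m * sin (real (2 * Suc m + 1) * t)"
    unfolding product by (simp add: algebra_simps)
  finally have even: "sin t * even_binomial_poly (Suc m) ?y =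
      (-1) ^ Suc m * sin (real (2 * Suc m + 1) * t)" .
  have "sin t * cos t * odd_binomial_poly (Suc m) ?y =
      sin t * cos t * odd_binomial_poly m ?y + cos t * (sin t * even_binomial_poly (Suc m) ?y)"
    by (simp add: odd_binomial_poly_Suc algebra_simps)
  also have "\<dots> = (-1) ^ m * (sin (real (2 * (m + 1)) * t)
      - 2 * cos t * sin (real (2 * Suc m + 1) * t)) / 2"
    unfolding Suc.IH[THEN conjunct2] even by (simp add: algebra_simps)
  also have "\<dots> = (-1) ^ Suc m * sin (real (2 * (Suc m + 1)) * t) / 2"
    unfolding product by (simp add: algebra_simps)
  finally show ?case
    using even by blast
qed

text \<open>Multiplying by 2 sin h makes the sum telescope; keeping that factor on the left avoids
  assuming sin h nonzero.\<close>

lemma sum_sin_arith_progression: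
  fixes x h :: real
  shows "2 * sin h * (\<Sum>k<n. sin (x + 2 * real k * h)) = cos (x - h) - cos (x + (2 * real n - 1) * h)"
proof (induction n)
  case 0
  show ?case by simp
next
  case (Suc n)
  have "2 * sin h * sin (x + 2 * real n * h) =
      cos ((x + 2 * real n * h) - h) - cos ((x + 2 * real n * h) + h)"
    by (simp add: cos_add cos_diff)
  then show ?case
    using Suc by (simp add: algebra_simps)
qed

lemma sum_sin_equally_spaced:
  fixes a :: real
  assumes "n \<ge> 1"
  shows "(\<Sum>k<n. sin (real N * (a + 2 * real k * pi / real n))) =
    (if n dvd N then real n * sin (real N * a) else 0)"
proof (cases "n dvd N")
  case True
  then obtain q where q: "N = n * q" ..
  have "sin (real N * (a + 2 * real k * pi / real n)) = sin (real N * a)" for k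
  proof -
    have "real N * (a + 2 * real k * pi / real n) = real N * a + 2 * real (k * q) * pi"
      using assms q by (simp add: field_simps)
    then show ?thesis
      by (simp only: sin_add cos_2npi sin_2npi)
  qed
  then show ?thesis
    using True by simp
next
  case False
  \<comment> \<open>Half the increment 2 N pi / n between consecutive arguments of the sine.\<close>
  define h where "h = real N * pi / real n"
  have "sin h \<noteq> 0"
  proof
    assume "sin h = 0"
    then obtain i :: int where "h = of_int i * pi"
      using sin_zero_iff_int2 by auto
    then have "real N = of_int i * real n"
      using assms by (simp add: h_def field_simps)
    then have "int N = i * int n"
      by (metis of_int_eq_iff of_int_mult of_int_of_nat_eq)
    then show False
      using False by (metis dvd_triv_right int_dvd_int_iff)
  qed
  \<comment> \<open>The n increments add up to N full turns, so the two end cosines of the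
    telescoped sum agree.\<close>
  have "real N * a + (2 * real n - 1) * h = (real N * a - h) + 2 * real N * pi"
    using assms by (simp add: h_def field_simps)
  then have "cos (real N * a + (2 * real n - 1) * h) = cos (real N * a - h)"
    by (simp only: cos_add[of "real N * a - h"] cos_2npi sin_2npi)
  then have "2 * sin h * (\<Sum>k<n. sin (real N * a + 2 * real k * h)) = 0"
    by (simp add: sum_sin_arith_progression)
  then have "(\<Sum>k<n. sin (real N * a + 2 * real k * h)) = 0"
    using \<open>sin h \<noteq> 0\<close> by simp
  moreover have "real N * a + 2 * real k * h = real N * (a + 2 * real k * pi / real n)" for k
    using assms by (simp add: h_def field_simps)
  ultimately show ?thesis
    using False by simp
qed

lemma A_sum_eq_sum_sin:
  "A_sum m n a = (-1) ^ m * (\<Sum>k<n. sin (real (2 * m + 1) * (a + 2 * real k * pi / real n)))"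
proof -
  let ?t = "\<lambda>k. a + 2 * real k * pi / real n"
  have "A_sum m n a = (\<Sum>j\<le>m. \<Sum>k<n. (-4) ^ j * real ((m + j) choose (2 * j)) *
      (sin (?t k) * cos (?t k) ^ (2 * j)))"
    by (simp only: A_sum_def sum_distrib_left atLeast0AtMost atLeast0LessThan)
  also have "\<dots> = (\<Sum>k<n. sin (?t k) * even_binomial_poly m (-4 * (cos (?t k))\<^sup>2))"
    by (subst sum.swap) (simp only: even_binomial_poly_def sum_distrib_left power_mult_distrib
        power_mult[symmetric] mult_ac)
  finally show ?thesis
    by (simp only: sin_times_binomial_polys sum_distrib_left)
qed

lemma B_sum_eq_sum_sin:
  "B_sum m n a = (-1) ^ m / 2 * (\<Sum>k<n. sin (real (2 * (m + 1)) * (a + 2 * real k * pi / real n)))"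
proof -
  let ?t = "\<lambda>k. a + 2 * real k * pi / real n"
  have "B_sum m n a = (\<Sum>j\<le>m. \<Sum>k<n. (-4) ^ j * real ((m + j + 1) choose (2 * j + 1)) *
      (sin (?t k) * cos (?t k) ^ (2 * j + 1)))"
    by (simp only: B_sum_def sum_distrib_left atLeast0AtMost atLeast0LessThan)
  \<comment> \<open>One cosine is split off the odd power; the rest combines with (-4)^j into a j-th
    power.\<close>
  also have "\<dots> = (\<Sum>k<n. sin (?t k) * cos (?t k) * odd_binomial_poly m (-4 * (cos (?t k))\<^sup>2))"
    by (subst sum.swap) (simp only: odd_binomial_poly_def sum_distrib_left power_mult_distrib
        power_mult[symmetric] power_add power_one_right mult_ac)
  finally show ?thesis
    by (simp only: sin_times_binomial_polys sum_distrib_left times_divide_eq_left)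
qed

theorem mainTheorem1:
  fixes m n :: nat and a :: real
  assumes "n \<ge> 1"
  shows "([2 * m + 1 = 0] (mod n) \<longrightarrow>
            A_sum m n a = (-1) ^ m * real n * sin (real (2 * m + 1) * a)) \<and>
         (\<not> [2 * m + 1 = 0] (mod n) \<longrightarrow> A_sum m n a = 0) \<and>
         ([2 * (m + 1) = 0] (mod n) \<longrightarrow>
            B_sum m n a = (-1) ^ m * (real n / 2) * sin (real (2 * (m + 1)) * a)) \<and>
         (\<not> [2 * (m + 1) = 0] (mod n) \<longrightarrow> B_sum m n a = 0)"
  unfolding A_sum_eq_sum_sin B_sum_eq_sum_sin sum_sin_equally_spaced[OF assms] cong_0_iff
  by simp

end
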